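(* The balanced presentation of the trivial group $$\langle x,y\mid x^{-1}y^3x=y^4,\ x=y^{-1}xyx^{-1}\rangle$$ satisfies the Andrews--Curtis conjecture, i.e. it can be transformed into the empty presentation $\langle\ \mid\ \rangle$ by a finite sequence of $Q^{**}$-transformations.
   Context: A relation $u=v$ stands for the relator $uv^{-1}$. The $Q^{**}$-transformations of a finite presentation $\langle x_1,\dots,x_n\mid r_1,\dots,r_m\rangle$ are: (1) replace some $r_i$ by $r_i^{-1}$; (2) replace some $r_i$ by $r_ir_j$ with $j\neq i$; (3) replace some $r_i$ by $wr_iw^{-1}$ with $w$ in the free group $F(x_1,\dots,x_n)$; (4) add a generator $x_{n+1}$ and a relator $r_{m+1}=x_{n+1}$, or the inverse of this operation; (5) replace every $r_i$ by $\phi(r_i)$ for an automorphism $\phi$ of $F(x_1,\dots,x_n)$. *)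

theory Defs
  imports "HOL-Algebra.Elementary_Groups"
begin

section \<open>Free groups of finite rank as groups of reduced words\<close>

text \<open>
  The letter \<open>(i, True)\<close> is the generator with index \<open>i\<close> and \<open>(i, False)\<close> is its inverse.
  Indices start at 0, so the free group of rank \<open>n\<close> uses the indices \<open>0, ..., n - 1\<close>, and it is
  literally a subset of the free group of rank \<open>n + 1\<close>.
\<close>

type_synonym letter = "nat \<times> bool"
type_synonym word = "letter list"

definition inv_letter :: "letter \<Rightarrow> letter" where
  "inv_letter a = (fst a, \<not> snd a)"

fun reduced :: "word \<Rightarrow> bool" where
  "reduced [] \<longleftrightarrow> True"
| "reduced [a] \<longleftrightarrow> True"
| "reduced (a # b # w) \<longleftrightarrow> b \<noteq> inv_letter a \<and> reduced (b # w)"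

fun cons_reduce :: "letter \<Rightarrow> word \<Rightarrow> word" where
  "cons_reduce a [] = [a]"
| "cons_reduce a (b # w) = (if b = inv_letter a then w else a # b # w)"

definition reduce :: "word \<Rightarrow> word" where
  "reduce w = foldr cons_reduce w []"

definition free_group :: "nat \<Rightarrow> word monoid" where
  "free_group n =
     \<lparr>carrier = {w. reduced w \<and> fst ` set w \<subseteq> {..<n}},
      mult = (\<lambda>u v. reduce (u @ v)),
      one = []\<rparr>"

definition gen :: "nat \<Rightarrow> word" where
  "gen i = [(i, True)]"

lemma inv_letter_inv_letter [simp]: "inv_letter (inv_letter a) = a"
  by (simp add: inv_letter_def)

lemma fst_inv_letter [simp]: "fst (inv_letter a) = fst a"
  by (simp add: inv_letter_def)

lemma reduced_Cons_D: "reduced (a # w) \<Longrightarrow> reduced w"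
  by (cases w) auto

lemma reduced_cons_reduce: "reduced w \<Longrightarrow> reduced (cons_reduce a w)"
  by (cases w) (auto dest: reduced_Cons_D)

lemma cons_reduce_reduced: "reduced (a # w) \<Longrightarrow> cons_reduce a w = a # w"
  by (cases w) auto

lemma cons_reduce_cancel:
  assumes "reduced w"
  shows "cons_reduce a (cons_reduce (inv_letter a) w) = w"
proof (cases w)
  case Nil
  then show ?thesis by simp
next
  case (Cons b v)
  with assms show ?thesis
    by (cases v) auto
qed

lemma reduced_foldr: "reduced v \<Longrightarrow> reduced (foldr cons_reduce u v)"
  by (induction u) (auto intro: reduced_cons_reduce)

lemma reduce_reduced: "reduced w \<Longrightarrow> reduce w = w"
proof (induction w)
  case (Cons a w)
  then show ?case
    using reduced_Cons_D[of a w] cons_reduce_reduced[of a w] by (simp add: reduce_def)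
qed (simp add: reduce_def)

lemma foldr_cons_reduce:
  assumes "reduced v"
  shows "foldr cons_reduce (cons_reduce a u) v = cons_reduce a (foldr cons_reduce u v)"
  using cons_reduce_cancel[OF reduced_foldr[OF assms], of a]
  by (cases u) auto

lemma foldr_reduce:
  assumes "reduced v"
  shows "foldr cons_reduce (reduce u) v = foldr cons_reduce u v"
  unfolding reduce_def by (induction u) (auto simp: foldr_cons_reduce assms)

lemma reduce_append: "reduce (u @ v) = foldr cons_reduce u (reduce v)"
  by (simp add: reduce_def)

lemma reduced_reduce: "reduced (reduce w)"
  by (simp add: reduce_def reduced_foldr)

lemma fst_set_cons_reduce: "fst ` set (cons_reduce a w) \<subseteq> insert (fst a) (fst ` set w)"
  by (cases w) auto

lemma fst_set_reduce: "fst ` set (reduce w) \<subseteq> fst ` set w"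
proof (induction w)
  case (Cons a w)
  have "fst ` set (reduce (a # w)) \<subseteq> insert (fst a) (fst ` set (reduce w))"
    using fst_set_cons_reduce[of a "reduce w"] by (simp add: reduce_def)
  also have "\<dots> \<subseteq> insert (fst a) (fst ` set w)"
    using Cons by (rule insert_mono)
  finally show ?case by simp
qed (simp add: reduce_def)

lemma reduce_append_reduce_left: "reduce (reduce u @ v) = reduce (u @ v)"
  by (simp add: reduce_append foldr_reduce reduced_reduce)

lemma reduce_append_reduce_right: "reduce (u @ reduce v) = reduce (u @ v)"
  by (simp add: reduce_append reduce_reduced reduced_reduce)

lemma reduce_inverse: "reduce (rev (map inv_letter w) @ w) = []"
proof (induction w)
  case (Cons a w)
  have "cons_reduce (inv_letter a) (cons_reduce a (reduce w)) = reduce w"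
    using cons_reduce_cancel[OF reduced_reduce, of "inv_letter a" w] by simp
  with Cons show ?case
    by (simp add: reduce_def)
qed (simp add: reduce_def)

lemma group_free_group: "group (free_group n)"
proof (rule groupI)
  fix x assume x: "x \<in> carrier (free_group n)"
  let ?y = "reduce (rev (map inv_letter x))"
  have "?y \<in> carrier (free_group n)"
    using x fst_set_reduce[of "rev (map inv_letter x)"]
    by (auto simp: free_group_def reduced_reduce image_image subset_iff)
  moreover have "?y \<otimes>\<^bsub>free_group n\<^esub> x = \<one>\<^bsub>free_group n\<^esub>"
    by (simp add: free_group_def reduce_append_reduce_left reduce_inverse)
  ultimately show "\<exists>y\<in>carrier (free_group n). y \<otimes>\<^bsub>free_group n\<^esub> x = \<one>\<^bsub>free_group n\<^esub>"
    by blast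
next
  fix x y assume "x \<in> carrier (free_group n)" "y \<in> carrier (free_group n)"
  then show "x \<otimes>\<^bsub>free_group n\<^esub> y \<in> carrier (free_group n)"
    using fst_set_reduce[of "x @ y"] by (fastforce simp: free_group_def reduced_reduce)
qed (auto simp: free_group_def reduce_reduced
       reduce_append_reduce_left reduce_append_reduce_right)


section \<open>Finite presentations\<close>

text \<open>
  The pair \<open>(n, [r\<^sub>1, ..., r\<^sub>m])\<close> stands for the presentation with generators \<open>gen 0, ..., gen (n - 1)\<close>
  and relators \<open>r\<^sub>1, ..., r\<^sub>m\<close>.
\<close>

type_synonym presentation = "nat \<times> word list"

fun is_presentation :: "presentation \<Rightarrow> bool" where
  "is_presentation (n, rs) \<longleftrightarrow> set rs \<subseteq> carrier (free_group n)"

fun balanced :: "presentation \<Rightarrow> bool" where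
  "balanced (n, rs) \<longleftrightarrow> length rs = n"

definition normal_closure :: "('a, 'b) monoid_scheme \<Rightarrow> 'a set \<Rightarrow> 'a set" where
  "normal_closure G S = \<Inter>{N. N \<lhd> G \<and> S \<subseteq> N}"

fun presented_group :: "presentation \<Rightarrow> word set monoid" where
  "presented_group (n, rs) = free_group n Mod normal_closure (free_group n) (set rs)"

definition relation :: "('a, 'b) monoid_scheme \<Rightarrow> 'a \<Rightarrow> 'a \<Rightarrow> 'a" where
  "relation G u v = u \<otimes>\<^bsub>G\<^esub> inv\<^bsub>G\<^esub> v"


section \<open>The \<open>Q\<^sup>*\<^sup>*\<close>-transformations\<close>

inductive Q_step :: "presentation \<Rightarrow> presentation \<Rightarrow> bool" where
  invert:
    "i < length rs \<Longrightarrow> Q_step (n, rs) (n, rs[i := inv\<^bsub>free_group n\<^esub> (rs ! i)])"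
| multiply:
    "i < length rs \<Longrightarrow> j < length rs \<Longrightarrow> j \<noteq> i \<Longrightarrow>
     Q_step (n, rs) (n, rs[i := rs ! i \<otimes>\<^bsub>free_group n\<^esub> rs ! j])"
| conjugate:
    "i < length rs \<Longrightarrow> w \<in> carrier (free_group n) \<Longrightarrow>
     Q_step (n, rs)
       (n, rs[i := w \<otimes>\<^bsub>free_group n\<^esub> rs ! i \<otimes>\<^bsub>free_group n\<^esub> inv\<^bsub>free_group n\<^esub> w])"
| stabilize:
    "is_presentation (n, rs) \<Longrightarrow> Q_step (n, rs) (Suc n, rs @ [gen n])"
| destabilize:
    \<comment> \<open>the premise says that the remaining relators do not involve the removed generator\<close>
    "is_presentation (n, rs) \<Longrightarrow> Q_step (Suc n, rs @ [gen n]) (n, rs)"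
| automorphism:
    "\<phi> \<in> iso (free_group n) (free_group n) \<Longrightarrow> Q_step (n, rs) (n, map \<phi> rs)"

definition satisfies_Andrews_Curtis :: "presentation \<Rightarrow> bool" where
  "satisfies_Andrews_Curtis P \<longleftrightarrow> Q_step\<^sup>*\<^sup>* P (0, [])"

end

theory Submission
  imports Defs
begin

text \<open>
  The second relation says \<open>y\<^sup>-\<^sup>1 x y = x\<^sup>2\<close>, so it defines the Baumslag--Solitar group \<open>BS(1, 2)\<close>. In that
  group \<open>y\<^sup>-\<^sup>3 x y\<^sup>3 = x\<^sup>8\<close>, hence \<open>x\<^sup>-\<^sup>1 y\<^sup>3 x = y\<^sup>3 x\<^sup>-\<^sup>7\<close>, and modulo the second relator the first relation
  \<open>x\<^sup>-\<^sup>1 y\<^sup>3 x = y\<^sup>4\<close> becomes \<open>y\<^sup>3 x\<^sup>-\<^sup>7 = y\<^sup>4\<close>, that is \<open>y = x\<^sup>-\<^sup>7\<close>. Once \<open>y\<close> is a power of \<open>x\<close>, everything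
  commutes and the second relator \<open>x (y\<^sup>-\<^sup>1 x y x\<^sup>-\<^sup>1)\<^sup>-\<^sup>1\<close> collapses to \<open>x\<close>.

  This computation of the trivial group becomes a sequence of \<open>Q\<^sup>*\<^sup>*\<close>-transformations because every step
  uses one relator to rewrite the other: by \<open>Q_step_replace\<close>, a relator may be replaced by any word
  that has the same image in every group in which the other relators hold. The relator pairs are
  \<^item> \<open>x\<^sup>-\<^sup>1 y\<^sup>3 x y\<^sup>-\<^sup>4\<close> and \<open>x (y\<^sup>-\<^sup>1 x y x\<^sup>-\<^sup>1)\<^sup>-\<^sup>1\<close>;
  \<^item> \<open>y\<^sup>3 x\<^sup>-\<^sup>7 y\<^sup>-\<^sup>4\<close> and \<open>x (y\<^sup>-\<^sup>1 x y x\<^sup>-\<^sup>1)\<^sup>-\<^sup>1\<close>, by the second relator (\<open>conj_square_pow\<close>);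
  \<^item> \<open>y\<^sup>3 x\<^sup>-\<^sup>7 y\<^sup>-\<^sup>4\<close> and \<open>x\<^sup>8 y\<close>, since the old and the new second relator both become \<open>x\<close>
    when \<open>y = x\<^sup>-\<^sup>7\<close>;
  \<^item> \<open>x\<close> and \<open>x\<^sup>8 y\<close>, since \<open>y = x\<^sup>-\<^sup>8\<close> turns \<open>y\<^sup>3 x\<^sup>-\<^sup>7 y\<^sup>-\<^sup>4\<close> into \<open>x\<close>;
  \<^item> \<open>x\<close> and \<open>y\<close>,

  and the last pair is removed by two destabilizations.
\<close>

section \<open>Normal closures\<close>

lemma (in group) normal_carrier: "carrier G \<lhd> G"
  by (rule normal_invI) (auto simp: subgroup_self)

lemma (in group) normal_normal_closure: "normal_closure G S \<lhd> G" if "S \<subseteq> carrier G"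
proof (rule normal_invI)
  show "subgroup (normal_closure G S) G"
    unfolding normal_closure_def using normal_carrier that
    by (intro subgroups_Inter) (auto simp: normal_imp_subgroup)
next
  fix x h assume "x \<in> carrier G" "h \<in> normal_closure G S"
  then show "x \<otimes> h \<otimes> inv x \<in> normal_closure G S"
    by (auto simp: normal_closure_def normal.inv_op_closed2)
qed

lemma normal_closure_superset: "S \<subseteq> normal_closure G S"
  by (auto simp: normal_closure_def)

lemma normal_closure_minimal: "N \<lhd> G \<Longrightarrow> S \<subseteq> N \<Longrightarrow> normal_closure G S \<subseteq> N"
  by (auto simp: normal_closure_def)

text \<open>
  Testing against all homomorphisms turns congruences modulo a normal closure into equational
  reasoning in an arbitrary group. The groups \<open>H\<close> range over groups of cosets because the quotient
  by the normal closure is the only one that the proof tests.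
\<close>
lemma (in group) congruent_normal_closureI:
  assumes S: "S \<subseteq> carrier G" and a: "a \<in> carrier G" and b: "b \<in> carrier G"
    and eq: "\<And>(H :: 'a set monoid) h. group_hom G H h \<Longrightarrow> \<forall>s\<in>S. h s = \<one>\<^bsub>H\<^esub> \<Longrightarrow> h a = h b"
  shows "a \<otimes> inv b \<in> normal_closure G S"
proof -
  define N where "N = normal_closure G S"
  interpret N: normal N G
    unfolding N_def by (rule normal_normal_closure[OF S])
  let ?h = "\<lambda>g. N #> g"
  have hom: "group_hom G (G Mod N) ?h"
    by (intro group_hom.intro group_hom_axioms.intro is_group N.factorgroup_is_group
          N.r_coset_hom_Mod)
  have "\<forall>s\<in>S. ?h s = \<one>\<^bsub>G Mod N\<^esub>"
  proof
    fix s assume "s \<in> S"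
    then have "s \<in> N" "s \<in> carrier G"
      using normal_closure_superset[of S G] S by (auto simp: N_def)
    then show "N #> s = \<one>\<^bsub>G Mod N\<^esub>"
      by (simp add: FactGroup_def coset_join2[OF _ N.subgroup_axioms])
  qed
  from eq[OF hom this] have "N #> a = N #> b" .
  then have "a \<in> N #> b"
    using rcos_self[OF a N.subgroup_axioms] by simp
  then obtain k where "k \<in> N" "a = k \<otimes> b"
    by (auto simp: r_coset_def)
  with b show ?thesis
    by (simp add: m_assoc N_def[symmetric])
qed

section \<open>Replacing a relator modulo the others\<close>

text \<open>
  The multipliers \<open>g\<close> for which both \<open>g\<close> and its inverse can be put in front of every relator \<open>a\<close> at
  place \<open>i\<close> form a normal subgroup that contains the other relators. Asking for \<open>g\<close> and its inverse
  at once gives closure under inverses without having to reverse a sequence of transformations;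
  asking it for every \<open>a\<close> gives closure under conjugation, by conjugating \<open>a\<close> before and after.
\<close>
lemma Q_step_multiply_normal_closure:
  fixes n rs i
  defines "F \<equiv> free_group n"
  assumes rs: "is_presentation (n, rs)" and i: "i < length rs"
    and g: "g \<in> normal_closure F {rs ! j | j. j < length rs \<and> j \<noteq> i}"
    and r: "r \<in> carrier F"
  shows "Q_step\<^sup>*\<^sup>* (n, rs[i := r]) (n, rs[i := g \<otimes>\<^bsub>F\<^esub> r])"
proof -
  interpret F: group F
    unfolding F_def by (rule group_free_group)
  define R where "R = (\<lambda>a b. Q_step\<^sup>*\<^sup>* (n, rs[i := a]) (n, rs[i := b]))"
  have trans: "R a c" if "R a b" "R b c" for a b c
    using that by (simp add: R_def)
  have inverse: "R a (inv\<^bsub>F\<^esub> a)" for a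
    using invert[of i "rs[i := a]" n] i by (auto simp: R_def F_def)
  have conj: "R a (w \<otimes>\<^bsub>F\<^esub> a \<otimes>\<^bsub>F\<^esub> inv\<^bsub>F\<^esub> w)" if "w \<in> carrier F" for a w
    using conjugate[of i "rs[i := a]" w n] i that by (auto simp: R_def F_def)
  have mult: "R a (a \<otimes>\<^bsub>F\<^esub> rs ! j)" if "j < length rs" "j \<noteq> i" for a j
    using multiply[of i "rs[i := a]" j n] i that by (auto simp: R_def F_def)
  define N where "N = {g \<in> carrier F. \<forall>a\<in>carrier F. R a (g \<otimes>\<^bsub>F\<^esub> a) \<and> R a (inv\<^bsub>F\<^esub> g \<otimes>\<^bsub>F\<^esub> a)}"
  have "N \<lhd> F"
  proof (rule F.normal_invI)
    show "subgroup N F"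
    proof (rule F.subgroupI)
      have "\<one>\<^bsub>F\<^esub> \<in> N"
        by (auto simp: N_def R_def)
      then show "N \<noteq> {}"
        by blast
    next
      fix g h assume g: "g \<in> N" and h: "h \<in> N"
      show "g \<otimes>\<^bsub>F\<^esub> h \<in> N"
        unfolding N_def
      proof (intro CollectI conjI ballI)
        fix a assume a: "a \<in> carrier F"
        have "R a (h \<otimes>\<^bsub>F\<^esub> a)" "R (h \<otimes>\<^bsub>F\<^esub> a) (g \<otimes>\<^bsub>F\<^esub> (h \<otimes>\<^bsub>F\<^esub> a))"
          using g h a by (auto simp: N_def)
        from trans[OF this] show "R a (g \<otimes>\<^bsub>F\<^esub> h \<otimes>\<^bsub>F\<^esub> a)"
          using g h a by (simp add: N_def F.m_assoc)
        have "R a (inv\<^bsub>F\<^esub> g \<otimes>\<^bsub>F\<^esub> a)"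
          "R (inv\<^bsub>F\<^esub> g \<otimes>\<^bsub>F\<^esub> a) (inv\<^bsub>F\<^esub> h \<otimes>\<^bsub>F\<^esub> (inv\<^bsub>F\<^esub> g \<otimes>\<^bsub>F\<^esub> a))"
          using g h a by (auto simp: N_def)
        from trans[OF this] show "R a (inv\<^bsub>F\<^esub> (g \<otimes>\<^bsub>F\<^esub> h) \<otimes>\<^bsub>F\<^esub> a)"
          using g h a by (simp add: N_def F.m_assoc F.inv_mult_group)
      qed (use g h in \<open>auto simp: N_def\<close>)
    qed (auto simp: N_def)
  next
    fix w g assume w: "w \<in> carrier F" and g: "g \<in> N"
    have conj_left: "R a (w \<otimes>\<^bsub>F\<^esub> k \<otimes>\<^bsub>F\<^esub> inv\<^bsub>F\<^esub> w \<otimes>\<^bsub>F\<^esub> a)"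
      if a: "a \<in> carrier F" and k: "k \<in> carrier F" "\<And>b. b \<in> carrier F \<Longrightarrow> R b (k \<otimes>\<^bsub>F\<^esub> b)" for a k
    proof -
      let ?b = "inv\<^bsub>F\<^esub> w \<otimes>\<^bsub>F\<^esub> a \<otimes>\<^bsub>F\<^esub> w"
      have ab: "R a ?b"
        using conj[of "inv\<^bsub>F\<^esub> w" a] w by simp
      have bk: "R ?b (k \<otimes>\<^bsub>F\<^esub> ?b)"
        using a w by (intro k) auto
      have kw: "R (k \<otimes>\<^bsub>F\<^esub> ?b) (w \<otimes>\<^bsub>F\<^esub> (k \<otimes>\<^bsub>F\<^esub> ?b) \<otimes>\<^bsub>F\<^esub> inv\<^bsub>F\<^esub> w)"
        by (rule conj[OF w])
      have "w \<otimes>\<^bsub>F\<^esub> (k \<otimes>\<^bsub>F\<^esub> ?b) \<otimes>\<^bsub>F\<^esub> inv\<^bsub>F\<^esub> w = w \<otimes>\<^bsub>F\<^esub> k \<otimes>\<^bsub>F\<^esub> inv\<^bsub>F\<^esub> w \<otimes>\<^bsub>F\<^esub> a"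
        using a w k(1) by (simp add: F.m_assoc)
      then show ?thesis
        using trans[OF trans[OF ab bk] kw] by simp
    qed
    have "inv\<^bsub>F\<^esub> (w \<otimes>\<^bsub>F\<^esub> g \<otimes>\<^bsub>F\<^esub> inv\<^bsub>F\<^esub> w) = w \<otimes>\<^bsub>F\<^esub> inv\<^bsub>F\<^esub> g \<otimes>\<^bsub>F\<^esub> inv\<^bsub>F\<^esub> w"
      using w g by (simp add: N_def F.m_assoc F.inv_mult_group)
    then show "w \<otimes>\<^bsub>F\<^esub> g \<otimes>\<^bsub>F\<^esub> inv\<^bsub>F\<^esub> w \<in> N"
      unfolding N_def using w g by (auto simp: N_def intro!: conj_left)
  qed
  moreover have "{rs ! j | j. j < length rs \<and> j \<noteq> i} \<subseteq> N"
  proof clarify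
    fix j assume j: "j < length rs" "j \<noteq> i"
    let ?s = "rs ! j"
    have s: "?s \<in> carrier F"
      using rs j by (auto simp: F_def)
    show "?s \<in> N"
      unfolding N_def
    proof (intro CollectI conjI ballI s)
      fix a assume a: "a \<in> carrier F"
      \<comment> \<open>relators are multiplied on the right only; conjugation moves the factor to the left\<close>
      have "?s \<otimes>\<^bsub>F\<^esub> (a \<otimes>\<^bsub>F\<^esub> ?s) \<otimes>\<^bsub>F\<^esub> inv\<^bsub>F\<^esub> ?s = ?s \<otimes>\<^bsub>F\<^esub> a"
        using a s by (simp add: F.m_assoc)
      then show "R a (?s \<otimes>\<^bsub>F\<^esub> a)"
        using trans[OF mult[OF j, of a] conj[OF s]] by simp
      have "inv\<^bsub>F\<^esub> (inv\<^bsub>F\<^esub> a \<otimes>\<^bsub>F\<^esub> ?s) = inv\<^bsub>F\<^esub> ?s \<otimes>\<^bsub>F\<^esub> a"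
        using a s by (simp add: F.inv_mult_group)
      then show "R a (inv\<^bsub>F\<^esub> ?s \<otimes>\<^bsub>F\<^esub> a)"
        using trans[OF trans[OF inverse[of a] mult[OF j]] inverse] by simp
    qed
  qed
  ultimately have "g \<in> N"
    using g normal_closure_minimal by blast
  with r have "R r (g \<otimes>\<^bsub>F\<^esub> r)"
    by (simp add: N_def)
  then show ?thesis
    by (simp add: R_def)
qed

text \<open>
  A calculation that is valid in every group satisfying the other relations is thereby a sequence
  of \<open>Q\<^sup>*\<^sup>*\<close>-transformations.
\<close>
lemma Q_step_replace:
  fixes n rs i
  defines "F \<equiv> free_group n"
  assumes rs: "is_presentation (n, rs)" and i: "i < length rs" and r: "r \<in> carrier F"
    and eq: "\<And>(H :: word set monoid) h. group_hom F H h \<Longrightarrow>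
               \<forall>j<length rs. j \<noteq> i \<longrightarrow> h (rs ! j) = \<one>\<^bsub>H\<^esub> \<Longrightarrow> h r = h (rs ! i)"
  shows "Q_step\<^sup>*\<^sup>* (n, rs) (n, rs[i := r])"
proof -
  interpret F: group F
    unfolding F_def by (rule group_free_group)
  have rs': "rs ! j \<in> carrier F" if "j < length rs" for j
    using rs that by (auto simp: F_def)
  let ?g = "r \<otimes>\<^bsub>F\<^esub> inv\<^bsub>F\<^esub> (rs ! i)"
  have "?g \<in> normal_closure F {rs ! j | j. j < length rs \<and> j \<noteq> i}"
    using rs' i r by (intro F.congruent_normal_closureI eq) auto
  from Q_step_multiply_normal_closure[OF rs i this[unfolded F_def], of "rs ! i"]
  have "Q_step\<^sup>*\<^sup>* (n, rs) (n, rs[i := ?g \<otimes>\<^bsub>F\<^esub> rs ! i])"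
    using rs'[OF i] by (simp add: F_def)
  moreover have "?g \<otimes>\<^bsub>F\<^esub> rs ! i = r"
    using rs'[OF i] r by (simp add: F.m_assoc)
  ultimately show ?thesis
    by simp
qed

lemma Q_step_replace_first:
  fixes n
  defines "F \<equiv> free_group n"
  assumes "r \<in> carrier F" "r' \<in> carrier F" "s \<in> carrier F"
    and "\<And>(H :: word set monoid) h. group_hom F H h \<Longrightarrow> h s = \<one>\<^bsub>H\<^esub> \<Longrightarrow> h r' = h r"
  shows "Q_step\<^sup>*\<^sup>* (n, [r, s]) (n, [r', s])"
  using Q_step_replace[of n "[r, s]" 0 r'] assms by (auto simp: less_Suc_eq)

lemma Q_step_replace_second:
  fixes n
  defines "F \<equiv> free_group n"
  assumes "r \<in> carrier F" "s \<in> carrier F" "s' \<in> carrier F"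
    and "\<And>(H :: word set monoid) h. group_hom F H h \<Longrightarrow> h r = \<one>\<^bsub>H\<^esub> \<Longrightarrow> h s' = h s"
  shows "Q_step\<^sup>*\<^sup>* (n, [r, s]) (n, [r, s'])"
  using Q_step_replace[of n "[r, s]" 1 s'] assms by (auto simp: less_Suc_eq)

section \<open>Presentations on the standard generators\<close>

lemma gen_closed: "i < n \<Longrightarrow> gen i \<in> carrier (free_group n)"
  by (simp add: gen_def free_group_def)

lemma Q_step_gens: "Q_step\<^sup>*\<^sup>* (n, map gen [0..<n]) (0, [])"
proof (induction n)
  case (Suc n)
  have "Q_step (Suc n, map gen [0..<n] @ [gen n]) (n, map gen [0..<n])"
    by (rule destabilize) (auto intro: gen_closed)
  with Suc show ?case
    by (auto intro: converse_rtranclp_into_rtranclp)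
qed simp

lemma subgroup_containing_gens:
  assumes N: "subgroup N (free_group n)" and gens: "\<And>i. i < n \<Longrightarrow> gen i \<in> N"
  shows "N = carrier (free_group n)"
proof
  interpret F: group "free_group n"
    by (rule group_free_group)
  show "N \<subseteq> carrier (free_group n)"
    using N by (rule subgroup.subset)
  have letter: "[a] \<in> N" if "fst a < n" for a
  proof -
    obtain i b where a: "a = (i, b)"
      by (cases a)
    have "[(i, False)] = inv\<^bsub>free_group n\<^esub> gen i"
      using that a
      by (intro F.inv_equality[symmetric] gen_closed)
        (auto simp: gen_def free_group_def reduce_def inv_letter_def)
    then show ?thesis
      using gens[of i] that a subgroup.m_inv_closed[OF N, of "gen i"] by (cases b) (auto simp: gen_def)
  qed
  show "carrier (free_group n) \<subseteq> N"
  proof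
    fix w assume "w \<in> carrier (free_group n)"
    then show "w \<in> N"
    proof (induction w)
      case Nil
      then show ?case
        using subgroup.one_closed[OF N] by (simp add: free_group_def)
    next
      case (Cons a w)
      have "w \<in> N" "[a] \<in> N"
        using Cons letter by (auto simp: free_group_def dest: reduced_Cons_D)
      then have "[a] \<otimes>\<^bsub>free_group n\<^esub> w \<in> N"
        by (intro subgroup.m_closed[OF N])
      then show ?case
        using Cons.prems by (simp add: free_group_def reduce_reduced)
    qed
  qed
qed

lemma trivial_presented_groupI:
  assumes rs: "is_presentation (n, rs)"
    and triv: "\<And>(H :: word set monoid) h i. group_hom (free_group n) H h \<Longrightarrow>
           \<forall>s\<in>set rs. h s = \<one>\<^bsub>H\<^esub> \<Longrightarrow> i < n \<Longrightarrow> h (gen i) = \<one>\<^bsub>H\<^esub>"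
  shows "trivial_group (presented_group (n, rs))"
proof -
  interpret F: group "free_group n"
    by (rule group_free_group)
  let ?N = "normal_closure (free_group n) (set rs)"
  have S: "set rs \<subseteq> carrier (free_group n)"
    using rs by simp
  interpret N: normal ?N "free_group n"
    by (rule F.normal_normal_closure[OF S])
  have "gen i \<in> ?N" if i: "i < n" for i
  proof -
    have "gen i \<otimes>\<^bsub>free_group n\<^esub> inv\<^bsub>free_group n\<^esub> \<one>\<^bsub>free_group n\<^esub> \<in> ?N"
      using S i by (intro F.congruent_normal_closureI) (auto simp: triv gen_closed group_hom.hom_one)
    then show ?thesis
      using i by (simp add: gen_closed)
  qed
  then have "?N = carrier (free_group n)"
    by (rule subgroup_containing_gens[OF N.subgroup_axioms])
  then show ?thesis
    using N.factorgroup_is_group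
    by (auto simp: trivial_group_def FactGroup_def RCOSETS_def F.coset_join2[OF _ F.subgroup_self])
qed

section \<open>Calculations in a group that satisfies one of the relations\<close>

context group
begin

lemma relation_eq_one_iff:
  "u \<in> carrier G \<Longrightarrow> v \<in> carrier G \<Longrightarrow> relation G u v = \<one> \<longleftrightarrow> u = v"
  by (metis relation_def inv_solve_right' l_one one_closed)

text \<open>
  Conjugation by \<open>y\<close> squares \<open>x\<close>, so conjugation by \<open>y\<^sup>3\<close> raises \<open>x\<close> to the power 8; one of the 8
  factors cancels against the \<open>x\<close> on the right.
\<close>
lemma conj_square_pow:
  assumes x: "x \<in> carrier G" and y: "y \<in> carrier G"
    and rel: "x = inv y \<otimes> x \<otimes> y \<otimes> inv x"
  shows "inv x \<otimes> y [^] (3::nat) \<otimes> x = y [^] (3::nat) \<otimes> inv (x [^] (7::nat))"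
proof -
  have "x \<otimes> x = inv y \<otimes> x \<otimes> y"
    using rel x y by (metis inv_solve_right inv_closed m_closed)
  then have xy: "x \<otimes> y = y \<otimes> (x \<otimes> x)"
    using x y by (metis inv_solve_left m_assoc inv_closed m_closed)
  have pow: "x [^] k \<otimes> y = y \<otimes> x [^] (2 * k)" for k :: nat
  proof (induction k)
    case (Suc k)
    have "x [^] Suc k \<otimes> y = x [^] k \<otimes> y \<otimes> (x \<otimes> x)"
      using x y xy by (simp add: m_assoc)
    also have "\<dots> = y \<otimes> x [^] (2 * Suc k)"
      using x y Suc by (simp add: m_assoc)
    finally show ?case .
  qed (use x y in simp)
  have "x \<otimes> y [^] (3::nat) = x [^] (1::nat) \<otimes> y \<otimes> y \<otimes> y"
    using x y by (simp add: numeral_eq_Suc m_assoc)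
  also have "\<dots> = y \<otimes> (x [^] (2::nat) \<otimes> y) \<otimes> y"
    using x y by (simp add: pow m_assoc del: nat_pow_Suc One_nat_def)
  also have "\<dots> = y \<otimes> y \<otimes> (x [^] (4::nat) \<otimes> y)"
    using x y by (simp add: pow m_assoc)
  also have "\<dots> = y [^] (3::nat) \<otimes> (x \<otimes> x [^] (7::nat))"
    using x y by (simp only: pow) (simp add: m_assoc numeral_eq_Suc)
  finally have xy3: "x \<otimes> y [^] (3::nat) = y [^] (3::nat) \<otimes> (x \<otimes> x [^] (7::nat))" .
  have "x \<otimes> (y [^] (3::nat) \<otimes> inv (x [^] (7::nat))) = y [^] (3::nat) \<otimes> x"
    using x y xy3 by (simp add: m_assoc flip: m_assoc[of x "y [^] 3"])
  then show ?thesis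
    using x y by (metis inv_solve_left m_assoc inv_closed m_closed nat_pow_closed)
qed

lemma cancel_pow_relation:
  assumes x: "x \<in> carrier G" and y: "y \<in> carrier G"
    and rel: "y [^] (3::nat) \<otimes> inv (x [^] (7::nat)) = y [^] (4::nat)"
  shows "y = x [^] (-7::int)"
proof -
  have "y [^] (4::nat) = y [^] (3::nat) \<otimes> y"
    by (simp add: numeral_eq_Suc)
  then have "y = inv (x [^] (7::nat))"
    using rel x y by (metis Units_eq Units_l_cancel nat_pow_closed inv_closed)
  then show ?thesis
    using x by (metis int_pow_neg_int of_nat_numeral)
qed

lemma relation_square_power:
  fixes k :: int
  assumes "x \<in> carrier G" "y = x [^] k"
  shows "relation G x (inv y \<otimes> x \<otimes> y \<otimes> inv x) = x"
proof -
  have "x \<otimes> y = y \<otimes> x"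
    using assms int_pow_mult[of x 1 k] int_pow_mult[of x k 1] by (simp add: add.commute)
  then show ?thesis
    using assms by (simp add: relation_def m_assoc inv_mult_group)
qed

lemma relation_pow_power:
  fixes k :: int
  assumes "x \<in> carrier G" "y = x [^] k"
  shows "relation G (y [^] (3::nat) \<otimes> inv (x [^] (7::nat))) (y [^] (4::nat)) = x [^] (- 7 - k)"
proof -
  have "relation G (y [^] (3::nat) \<otimes> inv (x [^] (7::nat))) (y [^] (4::nat))
      = x [^] (k * 3) \<otimes> x [^] (-7::int) \<otimes> x [^] (- (k * 4))"
    using assms int_pow_pow[of x k 3] int_pow_pow[of x k 4]
      int_pow_int[of G y 3] int_pow_int[of G y 4] int_pow_neg_int[of x 7]
    by (simp add: relation_def int_pow_neg)
  also have "\<dots> = x [^] (- 7 - k)"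
  proof -
    have "k * 3 + -7 + - (k * 4) = - 7 - k"
      by simp
    then show ?thesis
      using assms(1) by (simp only: int_pow_mult[symmetric])
  qed
  finally show ?thesis .
qed

lemma pow_mult_eq_oneD:
  assumes x: "x \<in> carrier G" and y: "y \<in> carrier G" and "x [^] (k::nat) \<otimes> y = \<one>"
  shows "y = x [^] (- int k)"
  using assms by (metis int_pow_neg_int inv_equality inv_inv nat_pow_closed)

end

section \<open>The trivialization\<close>

theorem mainTheorem4:
  shows "let F = free_group 2; x = gen 0; y = gen 1;
             P = (2,
               [relation F (inv\<^bsub>F\<^esub> x \<otimes>\<^bsub>F\<^esub> y [^]\<^bsub>F\<^esub> (3::nat) \<otimes>\<^bsub>F\<^esub> x) (y [^]\<^bsub>F\<^esub> (4::nat)),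
                relation F x (inv\<^bsub>F\<^esub> y \<otimes>\<^bsub>F\<^esub> x \<otimes>\<^bsub>F\<^esub> y \<otimes>\<^bsub>F\<^esub> inv\<^bsub>F\<^esub> x)])
         in is_presentation P \<and> balanced P \<and> trivial_group (presented_group P) \<and>
            satisfies_Andrews_Curtis P"
proof -
  define F where "F = free_group 2"
  define x where "x = gen 0"
  define y where "y = gen 1"
  interpret F: group F
    unfolding F_def by (rule group_free_group)
  have x: "x \<in> carrier F" and y: "y \<in> carrier F"
    by (auto simp: x_def y_def F_def intro: gen_closed)
  let ?r = "relation F (inv\<^bsub>F\<^esub> x \<otimes>\<^bsub>F\<^esub> y [^]\<^bsub>F\<^esub> (3::nat) \<otimes>\<^bsub>F\<^esub> x) (y [^]\<^bsub>F\<^esub> (4::nat))"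
  let ?s = "relation F x (inv\<^bsub>F\<^esub> y \<otimes>\<^bsub>F\<^esub> x \<otimes>\<^bsub>F\<^esub> y \<otimes>\<^bsub>F\<^esub> inv\<^bsub>F\<^esub> x)"
  let ?r' = "relation F (y [^]\<^bsub>F\<^esub> (3::nat) \<otimes>\<^bsub>F\<^esub> inv\<^bsub>F\<^esub> (x [^]\<^bsub>F\<^esub> (7::nat))) (y [^]\<^bsub>F\<^esub> (4::nat))"
  let ?s' = "x [^]\<^bsub>F\<^esub> (8::nat) \<otimes>\<^bsub>F\<^esub> y"
  have r: "?r \<in> carrier F" and s: "?s \<in> carrier F" and r': "?r' \<in> carrier F" and s': "?s' \<in> carrier F"
    using x y by (simp_all add: relation_def)
  then have pres: "is_presentation (2, [?r, ?s])"
    by (simp flip: F_def)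
  have r_eq: "h ?r' = h ?r" if "group_hom F H h" "h ?s = \<one>\<^bsub>H\<^esub>" for H :: "word set monoid" and h
  proof -
    interpret h: group_hom F H h by fact
    have "h x = inv\<^bsub>H\<^esub> h y \<otimes>\<^bsub>H\<^esub> h x \<otimes>\<^bsub>H\<^esub> h y \<otimes>\<^bsub>H\<^esub> inv\<^bsub>H\<^esub> h x"
      using that(2) x y by (subst h.H.relation_eq_one_iff[symmetric]) (auto simp: relation_def)
    from h.H.conj_square_pow[OF _ _ this] show ?thesis
      using x y by (simp add: relation_def h.hom_nat_pow)
  qed
  have y_eq: "h y = h x [^]\<^bsub>H\<^esub> (-7::int)"
    if "group_hom F H h" "h ?r' = \<one>\<^bsub>H\<^esub>" for H :: "word set monoid" and h
  proof -
    interpret h: group_hom F H h by fact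
    have "h y [^]\<^bsub>H\<^esub> (3::nat) \<otimes>\<^bsub>H\<^esub> inv\<^bsub>H\<^esub> (h x [^]\<^bsub>H\<^esub> (7::nat)) = h y [^]\<^bsub>H\<^esub> (4::nat)"
      using that(2) x y
      by (subst h.H.relation_eq_one_iff[symmetric]) (auto simp: relation_def h.hom_nat_pow)
    then show ?thesis
      using x y by (intro h.H.cancel_pow_relation) auto
  qed
  have s_eq: "h ?s = h x"
    if "group_hom F H h" "h y = h x [^]\<^bsub>H\<^esub> (k::int)" for H :: "word set monoid" and h k
  proof -
    interpret h: group_hom F H h by fact
    show ?thesis
      using h.H.relation_square_power[OF _ that(2)] x y by (simp add: relation_def)
  qed
  have s'_eq: "h ?s' = h x"
    if "group_hom F H h" "h y = h x [^]\<^bsub>H\<^esub> (-7::int)" for H :: "word set monoid" and h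
  proof -
    interpret h: group_hom F H h by fact
    have "h ?s' = h x [^]\<^bsub>H\<^esub> (8::int) \<otimes>\<^bsub>H\<^esub> h x [^]\<^bsub>H\<^esub> (-7::int)"
      using x y that(2) int_pow_int[of H "h x" 8] by (simp add: h.hom_nat_pow)
    then show ?thesis
      using x y by (simp flip: h.H.int_pow_mult)
  qed
  have x_eq: "h x = h ?r'"
    if "group_hom F H h" "h ?s' = \<one>\<^bsub>H\<^esub>" for H :: "word set monoid" and h
  proof -
    interpret h: group_hom F H h by fact
    have "h y = h x [^]\<^bsub>H\<^esub> (- int 8)"
      using x y that(2) by (intro h.H.pow_mult_eq_oneD) (auto simp: h.hom_nat_pow)
    from h.H.relation_pow_power[OF _ this] show ?thesis
      using x y by (simp add: relation_def h.hom_nat_pow)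
  qed
  have y'_eq: "h y = h ?s'" if "group_hom F H h" "h x = \<one>\<^bsub>H\<^esub>" for H :: "word set monoid" and h
  proof -
    interpret h: group_hom F H h by fact
    show ?thesis
      using x y that(2) by (simp add: h.hom_nat_pow)
  qed
  note replace_first = Q_step_replace_first[where n = 2, folded F_def]
  note replace_second = Q_step_replace_second[where n = 2, folded F_def]
  \<comment> \<open>The exponent 8 in \<open>?s'\<close> is chosen so that \<open>?s'\<close> is \<open>x\<close> when \<open>y = x\<^sup>-\<^sup>7\<close>, and so that the relation
     \<open>y = x\<^sup>-\<^sup>8\<close> it imposes differs by exactly one factor \<open>x\<close> from \<open>y = x\<^sup>-\<^sup>7\<close>.\<close>
  have step1: "Q_step\<^sup>*\<^sup>* (2, [?r, ?s]) (2, [?r', ?s])"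
  proof (rule replace_first[OF r r' s])
    fix H :: "word set monoid" and h
    assume hom: "group_hom F H h" and rel: "h ?s = \<one>\<^bsub>H\<^esub>"
    from r_eq[OF hom, OF rel] show "h ?r' = h ?r" .
  qed
  have step2: "Q_step\<^sup>*\<^sup>* (2, [?r', ?s]) (2, [?r', ?s'])"
  proof (rule replace_second[OF r' s s'])
    fix H :: "word set monoid" and h
    assume hom: "group_hom F H h" and rel: "h ?r' = \<one>\<^bsub>H\<^esub>"
    from y_eq[OF hom, OF rel] have y_pow: "h y = h x [^]\<^bsub>H\<^esub> (-7::int)" .
    show "h ?s' = h ?s"
      using s_eq[OF hom, OF y_pow] s'_eq[OF hom, OF y_pow] by (simp only:)
  qed
  have step3: "Q_step\<^sup>*\<^sup>* (2, [?r', ?s']) (2, [x, ?s'])"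
  proof (rule replace_first[OF r' x s'])
    fix H :: "word set monoid" and h
    assume hom: "group_hom F H h" and rel: "h ?s' = \<one>\<^bsub>H\<^esub>"
    from x_eq[OF hom, OF rel] show "h x = h ?r'" .
  qed
  have step4: "Q_step\<^sup>*\<^sup>* (2, [x, ?s']) (2, [x, y])"
  proof (rule replace_second[OF x s' y])
    fix H :: "word set monoid" and h
    assume hom: "group_hom F H h" and rel: "h x = \<one>\<^bsub>H\<^esub>"
    from y'_eq[OF hom, OF rel] show "h y = h ?s'" .
  qed
  have step5: "Q_step\<^sup>*\<^sup>* (2, [x, y]) (0, [])"
    using Q_step_gens[of 2] by (simp add: x_def y_def numeral_2_eq_2)
  have "satisfies_Andrews_Curtis (2, [?r, ?s])"
    unfolding satisfies_Andrews_Curtis_def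
    by (rule rtranclp_trans[OF step1 rtranclp_trans[OF step2
          rtranclp_trans[OF step3 rtranclp_trans[OF step4 step5]]]])
  moreover have "trivial_group (presented_group (2, [?r, ?s]))"
  proof (rule trivial_presented_groupI[OF pres])
    fix H :: "word set monoid" and h i
    assume "group_hom (free_group 2) H h" and rels: "\<forall>t\<in>set [?r, ?s]. h t = \<one>\<^bsub>H\<^esub>" and i: "i < (2::nat)"
    then have hom: "group_hom F H h"
      by (simp only: F_def)
    interpret h: group_hom F H h by fact
    have "h ?r = \<one>\<^bsub>H\<^esub>" and hs: "h ?s = \<one>\<^bsub>H\<^esub>"
      using rels by (simp_all only: list.set ball_simps)
    then have "h ?r' = \<one>\<^bsub>H\<^esub>"
      by (simp only: r_eq[OF hom, OF hs])
    from y_eq[OF hom, OF this] have y_pow: "h y = h x [^]\<^bsub>H\<^esub> (-7::int)" .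
    then have hx: "h x = \<one>\<^bsub>H\<^esub>"
      using s_eq[OF hom, OF y_pow] hs by (simp only:)
    then have hy: "h y = \<one>\<^bsub>H\<^esub>"
      using y_pow by (simp only: h.H.int_pow_one)
    from i consider "i = 0" | "i = 1"
      by linarith
    then show "h (gen i) = \<one>\<^bsub>H\<^esub>"
      using hx hy by cases (simp_all only: x_def y_def)
  qed
  ultimately show ?thesis
    using pres by (simp add: Let_def F_def x_def y_def)
qed

end
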